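(* Let $1<\alpha\le2$. If $f\in C^{\alpha}[0,1]$, then there is a closed set $A\subseteq[0,1]$ such that $\dim_H A=\alpha-1$ and $f|_A$ is convex or $f|_A$ is concave.
   Context: For $1<\alpha<2$, $C^{\alpha}[0,1]$ is the set of differentiable functions $f:[0,1]\to\mathbb R$ with $\sup\{|f'(x)-f'(y)|/|x-y|^{\alpha-1}: x\ne y,\ x,y\in[0,1]\}<\infty$. $C^2[0,1]$ is the set of twice differentiable functions $f:[0,1]\to\mathbb R$ with $f''$ continuous. For $A\subseteq[0,1]$, $f|_A$ is convex if for all $x_1<x_2<x_3$ in $A$ one has $\frac{f(x_2)-f(x_1)}{x_2-x_1}\le\frac{f(x_3)-f(x_2)}{x_3-x_2}$, and concave if the reverse inequality always holds. $\dim_H$ denotes Hausdorff dimension. *)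

theory Defs
  imports "HOL-Analysis.Analysis"
begin

text \<open>
  Hausdorff measure (without normalising constant) and Hausdorff dimension of a subset of a
  metric space. The empty set contributes 0 for every exponent (so that sequences also
  describe finite covers), and a nonempty set contributes 1 for exponent 0; the case split is
  needed because \<^term>\<open>(0::real) powr 0\<close> is 0. The boundedness requirement on the covering
  sets is needed because \<^const>\<open>diameter\<close> is real-valued and hence unspecified on unbounded sets.
\<close>

definition diam_gauge :: "real \<Rightarrow> 'a::metric_space set \<Rightarrow> ennreal" where
  "diam_gauge s U =
     (if U = {} then 0 else if s = 0 then 1 else ennreal (diameter U powr s))"

definition hausdorff_premeasure :: "real \<Rightarrow> real \<Rightarrow> 'a::metric_space set \<Rightarrow> ennreal" where
  "hausdorff_premeasure s \<delta> A =
     (INF U \<in> {U :: nat \<Rightarrow> 'a set. A \<subseteq> (\<Union>i. U i) \<and> (\<forall>i. bounded (U i) \<and> diameter (U i) \<le> \<delta>)}.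
        (\<Sum>i. diam_gauge s (U i)))"

definition hausdorff_measure :: "real \<Rightarrow> 'a::metric_space set \<Rightarrow> ennreal" where
  "hausdorff_measure s A = (SUP \<delta> \<in> {0<..}. hausdorff_premeasure s \<delta> A)"

definition hausdorff_dim :: "'a::metric_space set \<Rightarrow> ereal" where
  "hausdorff_dim A = (INF s \<in> {s. 0 \<le> s \<and> hausdorff_measure s A = 0}. ereal s)"

text \<open>
  Functions on the unit interval are represented by total functions on the reals whose values
  outside the interval are irrelevant; derivatives at the endpoints are one-sided.
\<close>

definition holder_deriv_class :: "real \<Rightarrow> (real \<Rightarrow> real) set" where
  "holder_deriv_class \<alpha> =
     {f. \<exists>f'. (\<forall>x\<in>{0..1}. (f has_real_derivative f' x) (at x within {0..1})) \<and>
              bdd_above {\<bar>f' x - f' y\<bar> / \<bar>x - y\<bar> powr (\<alpha> - 1) | x y.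
                           x \<in> {0..1} \<and> y \<in> {0..1} \<and> x \<noteq> y}}"

definition twice_cont_diff_class :: "(real \<Rightarrow> real) set" where
  "twice_cont_diff_class =
     {f. \<exists>f' f''. (\<forall>x\<in>{0..1}. (f has_real_derivative f' x) (at x within {0..1})) \<and>
                  (\<forall>x\<in>{0..1}. (f' has_real_derivative f'' x) (at x within {0..1})) \<and>
                  continuous_on {0..1} f''}"

text \<open>Only used for exponents in the interval from 1 (exclusive) to 2 (inclusive).\<close>

definition C_class :: "real \<Rightarrow> (real \<Rightarrow> real) set" where
  "C_class \<alpha> = (if \<alpha> = 2 then twice_cont_diff_class else holder_deriv_class \<alpha>)"

text \<open>
  The library notion \<^const>\<open>convex_on\<close> requires the domain to be convex, so convexity of a
  restriction to an arbitrary set is defined by comparing slopes.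
\<close>

definition restr_convex :: "real set \<Rightarrow> (real \<Rightarrow> real) \<Rightarrow> bool" where
  "restr_convex A f \<longleftrightarrow>
     (\<forall>x1\<in>A. \<forall>x2\<in>A. \<forall>x3\<in>A. x1 < x2 \<and> x2 < x3 \<longrightarrow>
        (f x2 - f x1) / (x2 - x1) \<le> (f x3 - f x2) / (x3 - x2))"

definition restr_concave :: "real set \<Rightarrow> (real \<Rightarrow> real) \<Rightarrow> bool" where
  "restr_concave A f \<longleftrightarrow>
     (\<forall>x1\<in>A. \<forall>x2\<in>A. \<forall>x3\<in>A. x1 < x2 \<and> x2 < x3 \<longrightarrow>
        (f x2 - f x1) / (x2 - x1) \<ge> (f x3 - f x2) / (x3 - x2))"

end

theory Submission
  imports Defs
begin

text \<open>Put \<open>s = \<alpha> - 1\<close>, so that \<open>f'\<close> is \<open>s\<close>-Hoelder. The set comes from lines that support the graph of \<open>f\<close>.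

  Suppose that the graph of \<open>f\<close> passes below its chord from \<open>0\<close> to \<open>1\<close>. Let \<open>\<sigma>\<close> be the slope of
  this chord, and let \<open>A\<close> be the set of points \<open>x\<close> at which the tangent has a slope in a short
  interval \<open>J = [\<sigma>, \<sigma> + \<epsilon>]\<close> and lies nowhere above the graph. On \<open>A\<close> the function has supporting lines,
  so its restriction is convex. For each \<open>t \<in> J\<close> the function \<open>f y - t y\<close> has a minimum on \<open>[0,1]\<close>, and
  if \<open>\<epsilon>\<close> is small it is attained only in the interior; there \<open>f' = t\<close>. So \<open>f'\<close> maps \<open>A\<close> onto the
  interval \<open>J\<close>, and since it is \<open>s\<close>-Hoelder, \<open>A\<close> must have positive \<open>s\<close>-dimensional content
  (lemma \<open>dyadic_content_pos_of_holder_onto\<close>). If the graph passes above its chord, the same is done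
  with \<open>- f\<close>, and if the graph is the chord, then every set will do.

  The set \<open>A\<close> may have a dimension greater than \<open>s\<close> (it contains an interval if \<open>f\<close> is strictly convex on
  \<open>[0,1]\<close>, for example), so it has to be thinned out to dimension exactly \<open>s\<close>
  (theorem \<open>compact_subset_hausdorff_dim_eq\<close>, a weak form of Besicovitch's theorem on subsets of
  finite measure). Here coverings by half-open dyadic intervals are used: as two such intervals are
  nested or disjoint, the content \<open>M\<close> of \<open>E\<close> in a dyadic interval \<open>I\<close> is at least
  \<open>min |I|\<^sup>s (M (E \<inter> L) + M (E \<inter> R))\<close>, where \<open>L\<close> and \<open>R\<close> are the halves of \<open>I\<close>.
  By compactness and the Brouwer reduction theorem, \<open>A\<close> has a minimal closed subset \<open>E\<close> of the same
  content. In such an \<open>E\<close> no dyadic interval can carry a surplus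
  \<open>M (E \<inter> L) + M (E \<inter> R) > |I|\<^sup>s\<close>, because then a small piece of \<open>E \<inter> I\<close> could be removed for free.
  So the content is additive on the halves of every dyadic interval
  (lemma \<open>minimal_content_additive\<close>). Therefore restricting the coverings to short intervals does not
  raise the content of \<open>E\<close>, and \<open>E\<close> has finite \<open>s\<close>-dimensional measure as well as positive content.\<close>

section \<open>Half-open dyadic intervals\<close>

definition dyadic_interval :: "nat \<Rightarrow> int \<Rightarrow> real set" where
  "dyadic_interval k j = {real_of_int j / 2 ^ k ..< (real_of_int j + 1) / 2 ^ k}"

definition dyadic_intervals :: "nat \<Rightarrow> real set set" where
  "dyadic_intervals n = {dyadic_interval k j | k j. n \<le> k}"

lemma dyadic_interval_memI: "n \<le> k \<Longrightarrow> dyadic_interval k j \<in> dyadic_intervals n"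
  unfolding dyadic_intervals_def by blast

lemma dyadic_intervals_antimono: "m \<le> n \<Longrightarrow> dyadic_intervals n \<subseteq> dyadic_intervals m"
  unfolding dyadic_intervals_def by force

lemma mem_dyadic_interval_iff: "x \<in> dyadic_interval k j \<longleftrightarrow> \<lfloor>x * 2 ^ k\<rfloor> = j"
  by (auto simp: dyadic_interval_def floor_eq_iff field_simps)

lemma floor_coarser_dyadic:
  fixes x :: real
  assumes "k \<le> l"
  shows "\<lfloor>x * 2 ^ k\<rfloor> = \<lfloor>x * 2 ^ l\<rfloor> div 2 ^ (l - k)"
proof -
  have "(2 :: real) ^ l = 2 ^ k * 2 ^ (l - k)"
    using assms by (simp flip: power_add)
  then have "x * 2 ^ k = x * 2 ^ l / real_of_int (2 ^ (l - k))"
    by simp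
  then show ?thesis
    using floor_divide_real_eq_div[of "2 ^ (l - k)" "x * 2 ^ l"] by simp
qed

lemma dyadic_interval_nested:
  assumes "k \<le> l" and "dyadic_interval l i \<inter> dyadic_interval k j \<noteq> {}"
  shows "dyadic_interval l i \<subseteq> dyadic_interval k j"
  using assms by (auto simp: mem_dyadic_interval_iff floor_coarser_dyadic)

lemma dyadic_interval_children:
  "dyadic_interval k j = dyadic_interval (Suc k) (2 * j) \<union> dyadic_interval (Suc k) (2 * j + 1)"
  "dyadic_interval (Suc k) (2 * j) \<inter> dyadic_interval (Suc k) (2 * j + 1) = {}"
proof -
  have "\<lfloor>x * 2 ^ k\<rfloor> = j \<longleftrightarrow> \<lfloor>x * 2 ^ Suc k\<rfloor> = 2 * j \<or> \<lfloor>x * 2 ^ Suc k\<rfloor> = 2 * j + 1" for x :: real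
  proof -
    have "\<lfloor>x * 2 ^ k\<rfloor> = \<lfloor>x * 2 ^ Suc k\<rfloor> div 2"
      using floor_coarser_dyadic[of k "Suc k" x] by simp
    then show ?thesis by presburger
  qed
  then show "dyadic_interval k j = dyadic_interval (Suc k) (2 * j) \<union> dyadic_interval (Suc k) (2 * j + 1)"
    unfolding set_eq_iff Un_iff mem_dyadic_interval_iff by blast
  show "dyadic_interval (Suc k) (2 * j) \<inter> dyadic_interval (Suc k) (2 * j + 1) = {}"
    by (auto simp: mem_dyadic_interval_iff)
qed

lemma dyadic_interval_nonempty: "dyadic_interval k j \<noteq> {}"
  by (simp add: dyadic_interval_def divide_strict_right_mono)

lemma bounded_dyadic_interval: "bounded (dyadic_interval k j)"
  by (simp add: dyadic_interval_def)

lemma diameter_dyadic_interval: "diameter (dyadic_interval k j) = 1 / 2 ^ k"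
proof -
  have lt: "real_of_int j / 2 ^ k < (real_of_int j + 1) / 2 ^ k"
    by (simp add: divide_strict_right_mono)
  have "diameter (closure (dyadic_interval k j)) = 1 / 2 ^ k"
    using lt unfolding dyadic_interval_def
    by (simp add: closure_atLeastLessThan add_divide_distrib)
  then show ?thesis
    by (simp add: diameter_closure bounded_dyadic_interval)
qed

lemma diam_gauge_empty [simp]: "diam_gauge s {} = 0"
  by (simp add: diam_gauge_def)

lemma diam_gauge_dyadic_interval:
  "0 < s \<Longrightarrow> diam_gauge s (dyadic_interval k j) = ennreal ((1 / 2 ^ k) powr s)"
  by (simp add: diam_gauge_def dyadic_interval_nonempty diameter_dyadic_interval)

lemma diam_gauge_mono:
  assumes "0 < s" "A \<subseteq> B" "bounded B"
  shows "diam_gauge s A \<le> diam_gauge s B"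
proof -
  have "diameter A \<le> diameter B" "0 \<le> diameter A"
    using assms by (auto intro: diameter_subset diameter_ge_0 bounded_subset)
  then show ?thesis
    using assms by (auto simp: diam_gauge_def intro!: ennreal_leI powr_mono2)
qed

text \<open>A dyadic interval that meets \<open>I\<close> but does not contain it lies in one of the halves of \<open>I\<close>; the bound on
  its level is what makes the halves visible in the arguments below.\<close>

lemma dyadic_interval_dichotomy:
  assumes "J \<in> insert {} (dyadic_intervals 0)"
  shows "dyadic_interval k j \<subseteq> J \<or> J \<inter> dyadic_interval k j = {} \<or>
         (J \<subseteq> dyadic_interval k j \<and> J \<in> dyadic_intervals (Suc k))"
proof (cases "J \<inter> dyadic_interval k j = {}")
  case False
  then obtain l i where J: "J = dyadic_interval l i"
    using assms by (auto simp: dyadic_intervals_def)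
  show ?thesis
  proof (cases "l \<le> k")
    case True
    then show ?thesis
      using False J dyadic_interval_nested[of l k j i] by blast
  next
    case gt: False
    then show ?thesis
      using False J dyadic_interval_nested[of k l i j] dyadic_interval_memI[of "Suc k" l i] by auto
  qed
qed auto

lemma Int_dyadic_interval:
  assumes "J \<in> insert {} (dyadic_intervals n)" "n \<le> k"
  shows "J \<inter> dyadic_interval k j \<in> insert {} (dyadic_intervals n)"
proof -
  have "J \<in> insert {} (dyadic_intervals 0)"
    using assms dyadic_intervals_antimono[of 0 n] by auto
  from dyadic_interval_dichotomy[OF this, of k j] show ?thesis
    using assms dyadic_interval_memI[OF assms(2), of j]
    by (auto simp: Int_absorb1 Int_absorb2)
qed

lemma Diff_dyadic_interval:
  assumes "J \<in> insert {} (dyadic_intervals 0)" "\<not> dyadic_interval k j \<subseteq> J"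
  shows "J - dyadic_interval k j \<in> insert {} (dyadic_intervals 0)"
  using dyadic_interval_dichotomy[OF assms(1), of k j] assms by (auto simp: Diff_triv)

lemma small_dyadic_power:
  fixes s e :: real
  assumes "0 < s" "0 < e"
  shows "\<exists>m. (1 / 2 ^ m) powr s < e"
proof -
  obtain m where m: "(1 / 2 :: real) ^ m < e powr (1 / s)"
    using real_arch_pow_inv[of "e powr (1 / s)" "1 / 2"] assms by auto
  then have "((1 / 2) ^ m) powr s < (e powr (1 / s)) powr s"
    using assms by (intro powr_less_mono2) auto
  then show ?thesis
    using assms by (auto simp: powr_powr power_one_over)
qed

section \<open>Dyadic net content\<close>

text \<open>Coverings are sequences that may contain the empty set, so that finite coverings are included.
  The number \<open>n\<close> bounds the lengths of the intervals by \<open>2\<^sup>-\<^sup>n\<close>.\<close>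

definition dyadic_covers :: "nat \<Rightarrow> real set \<Rightarrow> (nat \<Rightarrow> real set) set" where
  "dyadic_covers n S = {U. S \<subseteq> (\<Union>i. U i) \<and> (\<forall>i. U i \<in> insert {} (dyadic_intervals n))}"

definition dyadic_content :: "real \<Rightarrow> nat \<Rightarrow> real set \<Rightarrow> ennreal" where
  "dyadic_content s n S = (INF U \<in> dyadic_covers n S. \<Sum>i. diam_gauge s (U i))"

lemma dyadic_content_le_cover:
  "U \<in> dyadic_covers n S \<Longrightarrow> dyadic_content s n S \<le> (\<Sum>i. diam_gauge s (U i))"
  unfolding dyadic_content_def by (rule INF_lower)

lemma dyadic_content_mono:
  "S \<subseteq> T \<Longrightarrow> dyadic_content s n S \<le> dyadic_content s n T"
  unfolding dyadic_content_def dyadic_covers_def by (rule INF_superset_mono) auto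

lemma dyadic_content_le_gauge:
  assumes "J \<in> insert {} (dyadic_intervals n)" "S \<subseteq> J"
  shows "dyadic_content s n S \<le> diam_gauge s J"
proof -
  have "binaryset J {} \<in> dyadic_covers n S"
    using assms by (auto simp: dyadic_covers_def UN_binaryset_eq binaryset_def)
  from dyadic_content_le_cover[OF this, of s] show ?thesis
    by (simp add: suminf_binaryset_eq)
qed

lemma dyadic_content_empty [simp]: "dyadic_content s n {} = 0"
  using dyadic_content_le_gauge[of "{}" n "{}" s] by simp

lemma dyadic_content_countable_subadditive:
  "dyadic_content s n (\<Union>i. S i) \<le> (\<Sum>i. dyadic_content s n (S i))"
proof (rule ennreal_le_epsilon)
  fix e :: real
  assume fin: "(\<Sum>i. dyadic_content s n (S i)) < top" and e: "0 < e"
  have "\<exists>U \<in> dyadic_covers n (S i). (\<Sum>j. diam_gauge s (U j)) <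
          dyadic_content s n (S i) + ennreal (e * (1 / 2) ^ Suc i)" for i
  proof (rule INF_approx_ennreal)
    show "dyadic_content s n (S i) \<noteq> \<infinity>"
      using ennreal_suminf_lessD[OF fin, of i] by simp
  qed (use e in \<open>auto simp: dyadic_content_def\<close>)
  then obtain U where U: "\<And>i. U i \<in> dyadic_covers n (S i)"
    and cost: "\<And>i. (\<Sum>j. diam_gauge s (U i j)) < dyadic_content s n (S i) + ennreal (e * (1 / 2) ^ Suc i)"
    by metis
  define V where "V = (\<lambda>p. case prod_decode p of (i, j) \<Rightarrow> U i j)"
  have "V \<in> dyadic_covers n (\<Union>i. S i)"
  proof -
    have "x \<in> (\<Union>p. V p)" if x: "x \<in> S i" for x i
    proof -
      obtain j where "x \<in> U i j"
        using U[of i] x unfolding dyadic_covers_def by blast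
      then have "x \<in> V (prod_encode (i, j))"
        by (simp add: V_def)
      then show ?thesis by blast
    qed
    then show ?thesis
      using U by (auto simp: dyadic_covers_def V_def split: prod.split)
  qed
  then have "dyadic_content s n (\<Union>i. S i) \<le> (\<Sum>p. diam_gauge s (V p))"
    by (rule dyadic_content_le_cover)
  also have "\<dots> = (\<Sum>p. (\<lambda>(i, j). diam_gauge s (U i j)) (prod_decode p))"
    by (intro suminf_cong) (simp add: V_def split: prod.split)
  also have "\<dots> = (\<Sum>i. \<Sum>j. diam_gauge s (U i j))"
    by (rule suminf_ennreal_2dimen) simp
  also have "\<dots> \<le> (\<Sum>i. dyadic_content s n (S i) + ennreal (e * (1 / 2) ^ Suc i))"
    by (intro suminf_le less_imp_le cost) auto
  also have "\<dots> = (\<Sum>i. dyadic_content s n (S i)) + (\<Sum>i. ennreal (e * (1 / 2) ^ Suc i))"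
    by (rule suminf_add[symmetric]) auto
  also have "(\<Sum>i. ennreal (e * (1 / 2) ^ Suc i)) = ennreal e"
  proof -
    have "(\<lambda>i. e * (1 / 2) ^ Suc i) sums e"
      using sums_mult[OF power_half_series, of e] by simp
    then show ?thesis
      using e by (intro suminf_ennreal_eq) auto
  qed
  finally show "dyadic_content s n (\<Union>i. S i) \<le> (\<Sum>i. dyadic_content s n (S i)) + ennreal e" .
qed

lemma dyadic_content_Un:
  "dyadic_content s n (S \<union> T) \<le> dyadic_content s n S + dyadic_content s n T"
  using dyadic_content_countable_subadditive[of s n "binaryset S T"]
  by (simp add: UN_binaryset_eq suminf_binaryset_eq[where f = "dyadic_content s n"])

text \<open>A closed interval of length \<open>2\<^sup>-\<^sup>m\<close> meets at most two half-open dyadic intervals of that length.\<close>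

lemma dyadic_content_short_interval:
  assumes "0 < s" "S \<subseteq> {a .. a + 1 / 2 ^ m}"
  shows "dyadic_content s 0 S \<le> 2 * ennreal ((1 / 2 ^ m) powr s)"
proof -
  define j where "j = \<lfloor>a * 2 ^ m\<rfloor>"
  have j: "real_of_int j \<le> a * 2 ^ m" "a * 2 ^ m < real_of_int j + 1"
    unfolding j_def by linarith+
  have sub: "S \<subseteq> dyadic_interval m j \<union> dyadic_interval m (j + 1)"
  proof
    fix y assume "y \<in> S"
    then have "a \<le> y" "y \<le> a + 1 / 2 ^ m"
      using assms by auto
    then have "a * 2 ^ m \<le> y * 2 ^ m" "y * 2 ^ m \<le> a * 2 ^ m + 1"
      by (auto simp: field_simps)
    then have "\<lfloor>y * 2 ^ m\<rfloor> = j \<or> \<lfloor>y * 2 ^ m\<rfloor> = j + 1"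
      using j by linarith
    then show "y \<in> dyadic_interval m j \<union> dyadic_interval m (j + 1)"
      by (simp add: mem_dyadic_interval_iff)
  qed
  have piece: "dyadic_content s 0 (dyadic_interval m i) \<le> ennreal ((1 / 2 ^ m) powr s)" for i
    using dyadic_content_le_gauge[of "dyadic_interval m i" 0 "dyadic_interval m i" s]
      dyadic_interval_memI[of 0 m i] diam_gauge_dyadic_interval[OF assms(1)] by simp
  have "dyadic_content s 0 S \<le> dyadic_content s 0 (dyadic_interval m j \<union> dyadic_interval m (j + 1))"
    by (rule dyadic_content_mono[OF sub])
  also have "\<dots> \<le> dyadic_content s 0 (dyadic_interval m j) + dyadic_content s 0 (dyadic_interval m (j + 1))"
    by (rule dyadic_content_Un)
  also have "\<dots> \<le> 2 * ennreal ((1 / 2 ^ m) powr s)"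
    unfolding mult_2 by (intro add_mono piece)
  finally show ?thesis .
qed

lemma dyadic_content_singleton:
  assumes "0 < s"
  shows "dyadic_content s 0 {x} = 0"
proof -
  have "dyadic_content s 0 {x} \<le> 0"
  proof (rule ennreal_le_epsilon)
    fix e :: real assume "0 < e"
    then obtain m where m: "(1 / 2 ^ m) powr s < e / 2"
      using small_dyadic_power[OF assms, of "e / 2"] by auto
    have "dyadic_content s 0 {x} \<le> 2 * ennreal ((1 / 2 ^ m) powr s)"
      by (rule dyadic_content_short_interval[OF assms]) auto
    also have "\<dots> = ennreal (2 * (1 / 2 ^ m) powr s)"
      by (simp add: ennreal_mult)
    also have "\<dots> \<le> ennreal e"
      using m by (intro ennreal_leI) linarith
    finally show "dyadic_content s 0 {x} \<le> 0 + ennreal e" by simp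
  qed
  then show ?thesis by simp
qed

lemma ennreal_term_le_suminf: "f i \<le> (\<Sum>i. f i :: ennreal)"
  using sum_le_suminf[of f "{i}"] by simp

lemma ennreal_less_gap:
  fixes x y :: ennreal
  assumes "x < y"
  shows "\<exists>e>0. x + ennreal e < y"
proof -
  obtain z where z: "x < z" "z < y"
    using dense[OF assms] by blast
  obtain r where r: "x = ennreal r" "0 \<le> r"
    using z(1) by (cases x) auto
  obtain t where t: "z = ennreal t" "0 \<le> t"
    using z(2) by (cases z) auto
  have "r < t"
    using z(1) unfolding r t by (simp add: ennreal_less_iff r)
  moreover have "ennreal r + ennreal (t - r) = ennreal t"
    using \<open>r < t\<close> r by (simp flip: ennreal_plus)
  ultimately show ?thesis
    using z(2) r t by (intro exI[of _ "t - r"]) simp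
qed

text \<open>A covering of \<open>S \<inter> I\<close> either uses an interval that contains \<open>I\<close> and so costs at least as much as \<open>I\<close>,
  or each of its members serves only one of the two halves, so that it splits into coverings of the
  halves. For coverings by arbitrary sets a member could serve both halves, and this would fail.\<close>

lemma dyadic_content_split:
  assumes s: "0 < s"
  shows "min (diam_gauge s (dyadic_interval k j))
           (dyadic_content s 0 (S \<inter> dyadic_interval (Suc k) (2 * j)) +
            dyadic_content s 0 (S \<inter> dyadic_interval (Suc k) (2 * j + 1)))
         \<le> dyadic_content s 0 (S \<inter> dyadic_interval k j)"
    (is "min (diam_gauge s ?I) (dyadic_content s 0 (S \<inter> ?L) + dyadic_content s 0 (S \<inter> ?R)) \<le> _")
  unfolding dyadic_content_def[of s 0 "S \<inter> ?I"]
proof (rule INF_greatest)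
  fix U assume "U \<in> dyadic_covers 0 (S \<inter> ?I)"
  then have cov: "S \<inter> ?I \<subseteq> (\<Union>i. U i)" and U: "\<And>i. U i \<in> insert {} (dyadic_intervals 0)"
    by (auto simp: dyadic_covers_def)
  show "min (diam_gauge s ?I) (dyadic_content s 0 (S \<inter> ?L) + dyadic_content s 0 (S \<inter> ?R))
          \<le> (\<Sum>i. diam_gauge s (U i))"
  proof (cases "\<exists>i. ?I \<subseteq> U i")
    case True
    then obtain i where i: "?I \<subseteq> U i" by blast
    have "bounded (U i)"
      using U[of i] by (auto simp: dyadic_intervals_def bounded_dyadic_interval)
    then have "diam_gauge s ?I \<le> diam_gauge s (U i)"
      using i s by (intro diam_gauge_mono) auto
    also have "\<dots> \<le> (\<Sum>i. diam_gauge s (U i))"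
      by (rule ennreal_term_le_suminf)
    finally show ?thesis by (simp add: min.coboundedI1)
  next
    case False
    have children: "?I = ?L \<union> ?R" "?L \<inter> ?R = {}"
      by (rule dyadic_interval_children)+
    have halves: "diam_gauge s (U i \<inter> ?L) + diam_gauge s (U i \<inter> ?R) \<le> diam_gauge s (U i)" for i
    proof -
      consider "U i \<inter> ?I = {}" | "U i \<subseteq> ?I" "U i \<in> dyadic_intervals (Suc k)"
        using dyadic_interval_dichotomy[OF U, of k j i] False by blast
      then show ?thesis
      proof cases
        case 1
        then have "U i \<inter> ?L = {}" "U i \<inter> ?R = {}"
          using children by blast+
        then show ?thesis by simp
      next
        case 2
        then obtain l m where lm: "U i = dyadic_interval l m" "Suc k \<le> l"
          by (auto simp: dyadic_intervals_def)
        have "U i \<inter> ?L = {} \<or> U i \<subseteq> ?L" "U i \<inter> ?R = {} \<or> U i \<subseteq> ?R"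
          using dyadic_interval_nested[OF lm(2)] unfolding lm(1) by blast+
        then consider "U i \<inter> ?L = {}" "U i \<inter> ?R = U i" | "U i \<inter> ?L = U i" "U i \<inter> ?R = {}"
          using children 2 by blast
        then show ?thesis by cases simp_all
      qed
    qed
    have part: "dyadic_content s 0 (S \<inter> J) \<le> (\<Sum>i. diam_gauge s (U i \<inter> J))"
      if "J = ?L \<or> J = ?R" for J
    proof (rule dyadic_content_le_cover)
      have "J \<subseteq> ?I" using that children by blast
      then have "S \<inter> J \<subseteq> (\<Union>i. U i \<inter> J)" using cov by blast
      moreover have "U i \<inter> J \<in> insert {} (dyadic_intervals 0)" for i
        using that Int_dyadic_interval[OF U[of i]] by blast
      ultimately show "(\<lambda>i. U i \<inter> J) \<in> dyadic_covers 0 (S \<inter> J)"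
        by (auto simp: dyadic_covers_def)
    qed
    have "dyadic_content s 0 (S \<inter> ?L) + dyadic_content s 0 (S \<inter> ?R)
        \<le> (\<Sum>i. diam_gauge s (U i \<inter> ?L)) + (\<Sum>i. diam_gauge s (U i \<inter> ?R))"
      by (intro add_mono part) auto
    also have "\<dots> = (\<Sum>i. diam_gauge s (U i \<inter> ?L) + diam_gauge s (U i \<inter> ?R))"
      by (rule suminf_add) auto
    also have "\<dots> \<le> (\<Sum>i. diam_gauge s (U i))"
      by (intro suminf_le halves) auto
    finally show ?thesis by (simp add: min.coboundedI2)
  qed
qed

text \<open>If \<open>T \<inter> I\<close> is so large that covering \<open>I\<close> itself is no more expensive, then \<open>T\<close> may be filled up
  on \<open>I\<close> without raising the content: in any covering of \<open>T\<close> the part that lies in \<open>I\<close> can be exchanged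
  for the single interval \<open>I\<close>.\<close>

lemma dyadic_content_replace:
  assumes s: "0 < s"
    and big: "diam_gauge s (dyadic_interval k j) \<le> dyadic_content s 0 (T \<inter> dyadic_interval k j)"
    and sub: "S \<subseteq> T \<union> dyadic_interval k j"
  shows "dyadic_content s 0 S \<le> dyadic_content s 0 T"
    (is "_ \<le> ?M T")
  unfolding dyadic_content_def[of s 0 T]
proof (rule INF_greatest)
  let ?I = "dyadic_interval k j"
  fix U assume U: "U \<in> dyadic_covers 0 T"
  then have cov: "T \<subseteq> (\<Union>i. U i)" and Ui: "\<And>i. U i \<in> insert {} (dyadic_intervals 0)"
    by (auto simp: dyadic_covers_def)
  show "?M S \<le> (\<Sum>i. diam_gauge s (U i))"
  proof (cases "\<exists>i. ?I \<subseteq> U i")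
    case True
    then have "U \<in> dyadic_covers 0 S"
      using cov Ui sub unfolding dyadic_covers_def by blast
    then show ?thesis by (rule dyadic_content_le_cover)
  next
    case False
    have cost: "diam_gauge s (U i \<inter> ?I) + diam_gauge s (U i - ?I) \<le> diam_gauge s (U i)" for i
    proof -
      consider "U i \<inter> ?I = {}" | "U i \<subseteq> ?I"
        using dyadic_interval_dichotomy[OF Ui, of k j i] False by blast
      then show ?thesis
      proof cases
        case 2
        then have "U i - ?I = {}" "U i \<inter> ?I = U i" by blast+
        then show ?thesis by (simp only: diam_gauge_empty) simp
      qed (simp add: Diff_triv)
    qed
    have "?M S \<le> ?M (?I \<union> (T - ?I))"
      using sub by (intro dyadic_content_mono) blast
    also have "\<dots> \<le> ?M ?I + ?M (T - ?I)"
      by (rule dyadic_content_Un)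
    finally have "?M S \<le> ?M ?I + ?M (T - ?I)" .
    moreover have "?M ?I \<le> (\<Sum>i. diam_gauge s (U i \<inter> ?I))"
    proof -
      have "?M ?I \<le> diam_gauge s ?I"
        using dyadic_interval_memI[of 0 k j] by (intro dyadic_content_le_gauge) auto
      also have "\<dots> \<le> ?M (T \<inter> ?I)" by (rule big)
      also have "\<dots> \<le> (\<Sum>i. diam_gauge s (U i \<inter> ?I))"
      proof (rule dyadic_content_le_cover)
        show "(\<lambda>i. U i \<inter> ?I) \<in> dyadic_covers 0 (T \<inter> ?I)"
          using cov Int_dyadic_interval[OF Ui le0] by (fastforce simp: dyadic_covers_def)
      qed
      finally show ?thesis .
    qed
    moreover have "?M (T - ?I) \<le> (\<Sum>i. diam_gauge s (U i - ?I))"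
    proof (rule dyadic_content_le_cover)
      show "(\<lambda>i. U i - ?I) \<in> dyadic_covers 0 (T - ?I)"
        using cov Diff_dyadic_interval[OF Ui, of k j] False by (auto simp: dyadic_covers_def)
    qed
    ultimately have "?M S \<le> (\<Sum>i. diam_gauge s (U i \<inter> ?I)) + (\<Sum>i. diam_gauge s (U i - ?I))"
      by (meson add_mono order_trans)
    also have "(\<Sum>i. diam_gauge s (U i \<inter> ?I)) + (\<Sum>i. diam_gauge s (U i - ?I)) =
        (\<Sum>i. diam_gauge s (U i \<inter> ?I) + diam_gauge s (U i - ?I))"
      by (rule suminf_add) auto
    also have "\<dots> \<le> (\<Sum>i. diam_gauge s (U i))"
      by (intro suminf_le cost) auto
    finally show ?thesis .
  qed
qed

text \<open>Half-open intervals are not open, but only the left endpoint is in the way: adding a very short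
  interval to the left of each member of a covering makes an open set at an arbitrarily small
  extra cost.\<close>

lemma dyadic_content_open_superset:
  assumes s: "0 < s" and lt: "dyadic_content s 0 S < c"
  obtains G where "open G" "S \<subseteq> G" "dyadic_content s 0 G < c"
proof -
  obtain U where U: "U \<in> dyadic_covers 0 S" and cost: "(\<Sum>i. diam_gauge s (U i)) < c"
    using lt unfolding dyadic_content_def INF_less_iff by blast
  then have cov: "S \<subseteq> (\<Union>i. U i)" and Ui: "\<And>i. U i \<in> insert {} (dyadic_intervals 0)"
    by (auto simp: dyadic_covers_def)
  obtain e :: real where e: "0 < e" "(\<Sum>i. diam_gauge s (U i)) + ennreal e < c"
    using ennreal_less_gap[OF cost] by blast
  have "\<exists>V. open V \<and> U i \<subseteq> V \<and>
          dyadic_content s 0 V \<le> diam_gauge s (U i) + ennreal (e * (1 / 2) ^ Suc i)" for i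
  proof (cases "U i = {}")
    case True
    then show ?thesis by (intro exI[of _ "{}"]) auto
  next
    case False
    then obtain k j where kj: "U i = dyadic_interval k j"
      using Ui[of i] by (auto simp: dyadic_intervals_def)
    define a b where "a = real_of_int j / 2 ^ k" and "b = (real_of_int j + 1) / 2 ^ k"
    obtain m where m: "(1 / 2 ^ m) powr s < e * (1 / 2) ^ Suc i / 2"
      using small_dyadic_power[OF s, of "e * (1 / 2) ^ Suc i / 2"] e by auto
    define V where "V = {a - 1 / 2 ^ m <..< b}"
    have "V \<subseteq> U i \<union> {a - 1 / 2 ^ m .. a - 1 / 2 ^ m + 1 / 2 ^ m}"
      by (auto simp: V_def kj dyadic_interval_def a_def b_def)
    then have "dyadic_content s 0 V \<le>
        dyadic_content s 0 (U i \<union> {a - 1 / 2 ^ m .. a - 1 / 2 ^ m + 1 / 2 ^ m})"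
      by (rule dyadic_content_mono)
    also have "\<dots> \<le> dyadic_content s 0 (U i) +
        dyadic_content s 0 {a - 1 / 2 ^ m .. a - 1 / 2 ^ m + 1 / 2 ^ m}"
      by (rule dyadic_content_Un)
    also have "\<dots> \<le> diam_gauge s (U i) + 2 * ennreal ((1 / 2 ^ m) powr s)"
      by (intro add_mono dyadic_content_le_gauge[OF Ui] dyadic_content_short_interval[OF s]) auto
    also have "2 * ennreal ((1 / 2 ^ m) powr s) = ennreal (2 * (1 / 2 ^ m) powr s)"
      by (simp add: ennreal_mult)
    also have "\<dots> \<le> ennreal (e * (1 / 2) ^ Suc i)"
      using m by (intro ennreal_leI) linarith
    finally have "dyadic_content s 0 V \<le> diam_gauge s (U i) + ennreal (e * (1 / 2) ^ Suc i)"
      by (simp add: add_mono)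
    moreover have "open V"
      by (simp add: V_def)
    moreover have "U i \<subseteq> V"
    proof -
      have "a - 1 / 2 ^ m < a" by simp
      then have "a - 1 / 2 ^ m < x" if "a \<le> x" for x
        using that by linarith
      then show ?thesis
        by (auto simp: V_def kj dyadic_interval_def simp flip: a_def b_def)
    qed
    ultimately show ?thesis by blast
  qed
  then obtain V where V: "\<And>i. open (V i)" "\<And>i. U i \<subseteq> V i"
    and costV: "\<And>i. dyadic_content s 0 (V i) \<le> diam_gauge s (U i) + ennreal (e * (1 / 2) ^ Suc i)"
    by metis
  have "dyadic_content s 0 (\<Union>i. V i) \<le> (\<Sum>i. dyadic_content s 0 (V i))"
    by (rule dyadic_content_countable_subadditive)
  also have "\<dots> \<le> (\<Sum>i. diam_gauge s (U i) + ennreal (e * (1 / 2) ^ Suc i))"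
    by (intro suminf_le costV) auto
  also have "\<dots> = (\<Sum>i. diam_gauge s (U i)) + (\<Sum>i. ennreal (e * (1 / 2) ^ Suc i))"
    by (rule suminf_add[symmetric]) auto
  also have "(\<Sum>i. ennreal (e * (1 / 2) ^ Suc i)) = ennreal e"
    using sums_mult[OF power_half_series, of e] e by (intro suminf_ennreal_eq) auto
  finally have "dyadic_content s 0 (\<Union>i. V i) < c"
    using e(2) by (rule le_less_trans)
  moreover have "open (\<Union>i. V i)"
    using V(1) by blast
  moreover have "S \<subseteq> (\<Union>i. V i)"
    using cov UN_mono[OF subset_refl V(2)] by (rule order_trans)
  ultimately show thesis
    using that by blast
qed

text \<open>This is the closure property that the Brouwer reduction theorem asks for: an open superset of the
  intersection already contains some \<open>F n\<close>.\<close>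

lemma dyadic_content_Inter_decreasing:
  assumes s: "0 < s" and F: "\<And>n. compact (F n)" "\<And>n. F (Suc n) \<subseteq> F n"
    and c: "\<And>n. c \<le> dyadic_content s 0 (F n)"
  shows "c \<le> dyadic_content s 0 (\<Inter>n. F n)"
proof (rule ccontr)
  assume "\<not> ?thesis"
  then obtain G where G: "open G" "(\<Inter>n. F n) \<subseteq> G" "dyadic_content s 0 G < c"
    using dyadic_content_open_superset[OF s] by (metis not_le)
  have dec: "F n \<subseteq> F m" if "m \<le> n" for m n
    using lift_Suc_antimono_le[of F] F(2) that by blast
  have "\<exists>n. F n - G = {}"
  proof (rule ccontr)
    assume ne: "\<not> ?thesis"
    have "(\<Inter>n. F n - G) \<noteq> {}"
      using F(1) G(1) ne dec by (intro compact_nest compact_diff) blast+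
    then show False using G(2) by blast
  qed
  then obtain n where "F n \<subseteq> G" by blast
  then show False
    using c[of n] G(3) dyadic_content_mono[of "F n" G s 0] by (meson leD order_trans)
qed

section \<open>Content-minimal compact sets\<close>

lemma minimal_content_subset:
  assumes s: "0 < s" and A: "compact A"
  obtains E where "E \<subseteq> A" "compact E" "dyadic_content s 0 E = dyadic_content s 0 A"
    "\<And>E'. closed E' \<Longrightarrow> E' \<subset> E \<Longrightarrow> dyadic_content s 0 E' < dyadic_content s 0 E"
proof -
  let ?c = "dyadic_content s 0 A"
  define \<phi> where "\<phi> T \<longleftrightarrow> T \<subseteq> A \<and> ?c \<le> dyadic_content s 0 T" for T
  have "\<phi> (\<Inter>(range F))"
    if F: "\<And>n. closed (F n)" "\<And>n. \<phi> (F n)" "\<And>n. F (Suc n) \<subseteq> F n" for F :: "nat \<Rightarrow> real set"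
  proof -
    have sub: "F n \<subseteq> A" for n
      using F(2) by (simp add: \<phi>_def)
    then have "compact (F n)" for n
      using A F(1) by (metis compact_Int_closed inf.absorb_iff2)
    then have "?c \<le> dyadic_content s 0 (\<Inter>n. F n)"
      using F by (intro dyadic_content_Inter_decreasing s) (auto simp: \<phi>_def)
    then show ?thesis
      using sub by (auto simp: \<phi>_def)
  qed
  moreover have "closed A" "\<phi> A"
    using A by (auto simp: \<phi>_def compact_imp_closed)
  ultimately obtain E where E: "E \<subseteq> A" "closed E" "\<phi> E"
    and min: "\<And>T. T \<subseteq> A \<Longrightarrow> closed T \<Longrightarrow> \<phi> T \<Longrightarrow> \<not> T \<subset> E"
    using Brouwer_reduction_theorem_gen[of A \<phi>] by metis
  have eq: "dyadic_content s 0 E = ?c"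
    using E dyadic_content_mono[of E A s 0] by (auto simp: \<phi>_def)
  show thesis
  proof
    show "compact E"
      using A E by (metis compact_Int_closed inf.absorb_iff2)
    show "dyadic_content s 0 E' < dyadic_content s 0 E" if "closed E'" "E' \<subset> E" for E'
    proof (rule ccontr)
      assume "\<not> ?thesis"
      then have "\<phi> E'"
        using that(2) E(1) eq by (auto simp: \<phi>_def)
      then show False
        using min[of E'] that E(1) by blast
    qed
  qed (use E eq in auto)
qed

text \<open>Suppose the halves of \<open>I\<close> together have more content than \<open>|I|\<^sup>s\<close>. Removing from \<open>E\<close> a very short open
  interval inside \<open>I\<close> leaves them with at least \<open>|I|\<^sup>s\<close>. By \<open>dyadic_content_split\<close> the remaining set still
  has at least the content \<open>|I|\<^sup>s\<close> in \<open>I\<close>, and by \<open>dyadic_content_replace\<close> it has the same content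
  as \<open>E\<close>, against minimality.\<close>

lemma minimal_content_additive:
  assumes s: "0 < s" and E: "closed E"
    and min: "\<And>E'. closed E' \<Longrightarrow> E' \<subset> E \<Longrightarrow> dyadic_content s 0 E' < dyadic_content s 0 E"
  shows "dyadic_content s 0 (E \<inter> dyadic_interval (Suc k) (2 * j)) +
         dyadic_content s 0 (E \<inter> dyadic_interval (Suc k) (2 * j + 1))
         \<le> dyadic_content s 0 (E \<inter> dyadic_interval k j)"
    (is "?M (E \<inter> ?L) + ?M (E \<inter> ?R) \<le> ?M (E \<inter> ?I)")
proof (rule ccontr)
  assume "\<not> ?thesis"
  with dyadic_content_split[OF s, of k j E]
  have "diam_gauge s ?I < ?M (E \<inter> ?L) + ?M (E \<inter> ?R)"
    by (auto simp: min_def split: if_splits)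
  then obtain e where e: "0 < e" "diam_gauge s ?I + ennreal e < ?M (E \<inter> ?L) + ?M (E \<inter> ?R)"
    using ennreal_less_gap by blast
  define a b where "a = real_of_int j / 2 ^ k" and "b = (real_of_int j + 1) / 2 ^ k"
  have I: "?I = {a..<b}"
    by (simp add: dyadic_interval_def a_def b_def)
  have LR: "?L \<subseteq> ?I" "?R \<subseteq> ?I"
    using dyadic_interval_children(1)[of k j] by blast+
  \<comment> \<open>The left endpoint is avoided because an open interval around it would not lie in \<open>I\<close>. A set
    with no other point in \<open>I\<close> would have content \<open>0\<close> in both halves.\<close>
  obtain p where p: "p \<in> E" "a < p" "p < b"
  proof (rule ccontr)
    assume "\<not> thesis"
    then have "E \<inter> ?I \<subseteq> {a}"
      using that unfolding I by force
    then have "?M (E \<inter> J) \<le> ?M {a}" if "J \<subseteq> ?I" for J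
      using that by (intro dyadic_content_mono) blast
    then have "?M (E \<inter> ?L) = 0" "?M (E \<inter> ?R) = 0"
      using LR dyadic_content_singleton[OF s, of a] by auto
    then show False using e by simp
  qed
  \<comment> \<open>The removed interval costs at most two dyadic intervals in each half, four in all.\<close>
  obtain m where m: "(1 / 2 ^ m) powr s < e / 4"
    using small_dyadic_power[OF s, of "e / 4"] e by auto
  define r where "r = 1 / (2 :: real) ^ Suc m"
  have r: "0 < r" "r + r = 1 / 2 ^ m"
    by (auto simp: r_def field_simps)
  define G where "G = {max a (p - r) <..< min b (p + r)}"
  have G: "open G" "p \<in> G" "G \<subseteq> ?I"
    using p r by (auto simp: G_def I)
  have "G \<subseteq> {p - r .. p - r + 1 / 2 ^ m}"
    using r by (auto simp: G_def)
  then have "?M G \<le> 2 * ennreal ((1 / 2 ^ m) powr s)"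
    by (rule dyadic_content_short_interval[OF s])
  also have "\<dots> = ennreal (2 * (1 / 2 ^ m) powr s)"
    by (simp add: ennreal_mult)
  also have "\<dots> \<le> ennreal (e / 2)"
    using m by (intro ennreal_leI) linarith
  finally have MG: "?M G \<le> ennreal (e / 2)" .
  define E' where "E' = E - G"
  have "closed E'" "E' \<subset> E"
    using E G p by (auto simp: E'_def)
  have loss: "?M (E \<inter> J) \<le> ?M (E' \<inter> J) + ennreal (e / 2)" for J
  proof -
    have "?M (E \<inter> J) \<le> ?M (E' \<inter> J \<union> G)"
      by (rule dyadic_content_mono) (auto simp: E'_def)
    also have "\<dots> \<le> ?M (E' \<inter> J) + ?M G"
      by (rule dyadic_content_Un)
    also have "\<dots> \<le> ?M (E' \<inter> J) + ennreal (e / 2)"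
      using MG by (rule add_left_mono)
    finally show ?thesis .
  qed
  have "diam_gauge s ?I + ennreal e \<le> ?M (E \<inter> ?L) + ?M (E \<inter> ?R)"
    using e by simp
  also have "\<dots> \<le> (?M (E' \<inter> ?L) + ennreal (e / 2)) + (?M (E' \<inter> ?R) + ennreal (e / 2))"
    by (intro add_mono loss)
  also have "\<dots> = (?M (E' \<inter> ?L) + ?M (E' \<inter> ?R)) + (ennreal (e / 2) + ennreal (e / 2))"
    by (simp add: ac_simps)
  also have "ennreal (e / 2) + ennreal (e / 2) = ennreal e"
    using e by (simp flip: ennreal_plus)
  finally have "diam_gauge s ?I \<le> ?M (E' \<inter> ?L) + ?M (E' \<inter> ?R)"
    by (simp add: add.commute[of _ "ennreal e"] ennreal_add_left_cancel_le)
  then have "diam_gauge s ?I \<le> ?M (E' \<inter> ?I)"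
    using dyadic_content_split[OF s, of k j E'] by (simp add: min_def)
  moreover have "E \<subseteq> E' \<union> ?I"
    using G by (auto simp: E'_def)
  ultimately have "?M E \<le> ?M E'"
    by (rule dyadic_content_replace[OF s])
  then show False
    using min[OF \<open>closed E'\<close> \<open>E' \<subset> E\<close>] by simp
qed

text \<open>Within an interval of length at most \<open>2\<^sup>-\<^sup>n\<close>, coverings by longer intervals bring no advantage:
  such a covering may be replaced by the interval itself.\<close>

lemma dyadic_content_own_scale:
  assumes s: "0 < s" and nk: "n \<le> k"
  shows "dyadic_content s n (S \<inter> dyadic_interval k j) \<le> dyadic_content s 0 (S \<inter> dyadic_interval k j)"
  unfolding dyadic_content_def[of s 0]
proof (rule INF_greatest)
  let ?I = "dyadic_interval k j"
  fix U assume "U \<in> dyadic_covers 0 (S \<inter> ?I)"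
  then have cov: "S \<inter> ?I \<subseteq> (\<Union>i. U i)" and U: "\<And>i. U i \<in> insert {} (dyadic_intervals 0)"
    by (auto simp: dyadic_covers_def)
  have bdd: "bounded (U i)" for i
    using U[of i] by (auto simp: dyadic_intervals_def bounded_dyadic_interval)
  show "dyadic_content s n (S \<inter> ?I) \<le> (\<Sum>i. diam_gauge s (U i))"
  proof (cases "\<exists>i. ?I \<subseteq> U i")
    case True
    then obtain i where i: "?I \<subseteq> U i" by blast
    have "dyadic_content s n (S \<inter> ?I) \<le> diam_gauge s ?I"
      using dyadic_interval_memI[OF nk] by (intro dyadic_content_le_gauge) auto
    also have "\<dots> \<le> diam_gauge s (U i)"
      using i s bdd by (intro diam_gauge_mono) auto
    also have "\<dots> \<le> (\<Sum>i. diam_gauge s (U i))"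
      by (rule ennreal_term_le_suminf)
    finally show ?thesis .
  next
    case False
    have "U i \<inter> ?I \<in> insert {} (dyadic_intervals n)" for i
    proof -
      have "U i \<inter> ?I = {} \<or> U i \<inter> ?I = U i \<and> U i \<in> dyadic_intervals (Suc k)"
        using dyadic_interval_dichotomy[OF U, of k j i] False by blast
      then show ?thesis
        using dyadic_intervals_antimono[of n "Suc k"] nk by auto
    qed
    then have "(\<lambda>i. U i \<inter> ?I) \<in> dyadic_covers n (S \<inter> ?I)"
      using cov by (auto simp: dyadic_covers_def)
    then have "dyadic_content s n (S \<inter> ?I) \<le> (\<Sum>i. diam_gauge s (U i \<inter> ?I))"
      by (rule dyadic_content_le_cover)
    also have "\<dots> \<le> (\<Sum>i. diam_gauge s (U i))"
      using s bdd by (intro suminf_le diam_gauge_mono) auto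
    finally show ?thesis .
  qed
qed

text \<open>By additivity the content in \<open>I\<close> is at least the sum of the contents in the descendants of \<open>I\<close> at level
  \<open>n\<close>, and in these only short intervals are needed.\<close>

lemma dyadic_content_fine_le_coarse:
  assumes s: "0 < s"
    and add: "\<And>k j. dyadic_content s 0 (E \<inter> dyadic_interval (Suc k) (2 * j)) +
         dyadic_content s 0 (E \<inter> dyadic_interval (Suc k) (2 * j + 1))
         \<le> dyadic_content s 0 (E \<inter> dyadic_interval k j)"
  shows "dyadic_content s n (E \<inter> dyadic_interval k j) \<le> dyadic_content s 0 (E \<inter> dyadic_interval k j)"
proof (induction "n - k" arbitrary: k j)
  case 0
  then show ?case by (intro dyadic_content_own_scale s) simp
next
  case (Suc d)
  then have d: "d = n - Suc k" by simp
  let ?L = "dyadic_interval (Suc k) (2 * j)" and ?R = "dyadic_interval (Suc k) (2 * j + 1)"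
  have "dyadic_content s n (E \<inter> dyadic_interval k j) = dyadic_content s n (E \<inter> ?L \<union> E \<inter> ?R)"
    by (subst dyadic_interval_children(1)) (simp only: Int_Un_distrib)
  also have "\<dots> \<le> dyadic_content s n (E \<inter> ?L) + dyadic_content s n (E \<inter> ?R)"
    by (rule dyadic_content_Un)
  also have "\<dots> \<le> dyadic_content s 0 (E \<inter> ?L) + dyadic_content s 0 (E \<inter> ?R)"
    by (intro add_mono Suc.hyps(1) d)
  also have "\<dots> \<le> dyadic_content s 0 (E \<inter> dyadic_interval k j)"
    by (rule add)
  finally show ?case .
qed

section \<open>Hausdorff dimension\<close>

text \<open>Raising the exponent from \<open>s\<close> to \<open>t\<close> gains a factor \<open>(2\<^sup>-\<^sup>n)\<^sup>t\<^sup>-\<^sup>s\<close> for each interval of length at most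
  \<open>2\<^sup>-\<^sup>n\<close>.\<close>

lemma hausdorff_premeasure_le_dyadic_content:
  assumes s: "0 < s" "s < t" and n: "1 / 2 ^ n \<le> \<delta>" and lt: "dyadic_content s n S < C"
  shows "hausdorff_premeasure t \<delta> S \<le> ennreal ((1 / 2 ^ n) powr (t - s)) * C"
proof -
  let ?r = "ennreal ((1 / 2 ^ n) powr (t - s))"
  obtain U where "U \<in> dyadic_covers n S" and cost: "(\<Sum>i. diam_gauge s (U i)) < C"
    using lt unfolding dyadic_content_def INF_less_iff by blast
  then have cov: "S \<subseteq> (\<Union>i. U i)" and Ui: "\<And>i. U i \<in> insert {} (dyadic_intervals n)"
    by (auto simp: dyadic_covers_def)
  have U: "bounded (U i) \<and> diameter (U i) \<le> \<delta> \<and> diam_gauge t (U i) \<le> ?r * diam_gauge s (U i)" for i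
  proof (cases "U i = {}")
    case True
    then show ?thesis using n order_trans[of 0 "1 / 2 ^ n" \<delta>] by simp
  next
    case False
    then obtain l j where lj: "U i = dyadic_interval l j" "n \<le> l"
      using Ui[of i] by (auto simp: dyadic_intervals_def)
    have le: "1 / (2 :: real) ^ l \<le> 1 / 2 ^ n"
      using lj(2) by (simp add: frac_le power_increasing)
    have "(1 / 2 ^ l) powr t = (1 / 2 ^ l) powr (t - s) * (1 / 2 ^ l :: real) powr s"
      by (simp flip: powr_add)
    also have "\<dots> \<le> (1 / 2 ^ n) powr (t - s) * (1 / 2 ^ l) powr s"
      using le s by (intro mult_right_mono powr_mono2) auto
    finally have "diam_gauge t (U i) \<le> ?r * diam_gauge s (U i)"
      using s by (simp add: lj diam_gauge_dyadic_interval ennreal_leI flip: ennreal_mult)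
    then show ?thesis
      using le n by (simp add: lj bounded_dyadic_interval diameter_dyadic_interval)
  qed
  have "hausdorff_premeasure t \<delta> S \<le> (\<Sum>i. diam_gauge t (U i))"
    unfolding hausdorff_premeasure_def using cov U by (intro INF_lower) auto
  also have "\<dots> \<le> (\<Sum>i. ?r * diam_gauge s (U i))"
    using U by (intro suminf_le) auto
  also have "\<dots> = ?r * (\<Sum>i. diam_gauge s (U i))"
    by (rule ennreal_suminf_cmult)
  also have "\<dots> \<le> ?r * C"
    using cost by (intro mult_left_mono) auto
  finally show ?thesis .
qed

lemma hausdorff_dim_le_of_dyadic_content:
  assumes s: "0 < s" and bound: "\<And>n. dyadic_content s n S < ennreal C" and C: "0 < C"
  shows "hausdorff_dim S \<le> ereal s"
proof (rule ereal_le_epsilon2)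
  fix h :: real assume h: "0 < h"
  define t where "t = s + h"
  have "hausdorff_premeasure t \<delta> S \<le> 0" if \<delta>: "0 < \<delta>" for \<delta>
  proof (rule ennreal_le_epsilon)
    fix e :: real assume e: "0 < e"
    obtain m where m: "(1 / 2 ^ m) powr h < e / C"
      using small_dyadic_power[OF h, of "e / C"] e C by auto
    obtain m' where m': "(1 / 2 ^ m') powr 1 < \<delta>"
      using small_dyadic_power[of 1 \<delta>] \<delta> by auto
    define n where "n = max m m'"
    have small: "1 / (2 :: real) ^ n \<le> 1 / 2 ^ m" "1 / (2 :: real) ^ n \<le> 1 / 2 ^ m'"
      unfolding n_def by (auto intro!: frac_le power_increasing)
    have "1 / 2 ^ n \<le> \<delta>"
      using small(2) m' by simp
    then have "hausdorff_premeasure t \<delta> S \<le> ennreal ((1 / 2 ^ n) powr (t - s)) * ennreal C"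
      using s h bound by (intro hausdorff_premeasure_le_dyadic_content) (auto simp: t_def)
    also have "\<dots> = ennreal ((1 / 2 ^ n) powr h * C)"
      using C by (simp add: t_def ennreal_mult)
    also have "\<dots> \<le> ennreal e"
    proof (rule ennreal_leI)
      have "(1 / 2 ^ n) powr h \<le> (1 / 2 ^ m) powr h"
        using small h by (intro powr_mono2) auto
      then have "(1 / 2 ^ n) powr h * C \<le> (1 / 2 ^ m) powr h * C"
        using C by (intro mult_right_mono) auto
      also have "\<dots> < e"
        using m C by (simp add: pos_less_divide_eq)
      finally show "(1 / 2 ^ n) powr h * C \<le> e" by simp
    qed
    finally show "hausdorff_premeasure t \<delta> S \<le> 0 + ennreal e" by simp
  qed
  then have "hausdorff_measure t S = 0"
    unfolding hausdorff_measure_def by (auto intro!: SUP_eqI)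
  then have "hausdorff_dim S \<le> ereal t"
    unfolding hausdorff_dim_def using s h by (intro INF_lower) (auto simp: t_def)
  then show "hausdorff_dim S \<le> ereal s + ereal h"
    by (simp add: t_def)
qed

text \<open>A set of diameter \<open>d\<close> is covered by two dyadic intervals of length less than \<open>2 d\<close>. The gauge exponent
  may be any \<open>t \<le> s\<close> since \<open>d \<le> 1\<close>. The case \<open>d = 0\<close> is separate: the gauge of a point vanishes for
  positive exponents.\<close>

lemma dyadic_content_le_diam_gauge:
  fixes U :: "real set"
  assumes s: "0 < s" and t: "0 \<le> t" "t \<le> s" and U: "bounded U" "diameter U \<le> 1"
  shows "dyadic_content s 0 U \<le> ennreal (2 * 2 powr s) * diam_gauge t U"
proof (cases "U = {}")
  case False
  define d where "d = diameter U"
  have dist: "\<bar>x - y\<bar> \<le> d" if "x \<in> U" "y \<in> U" for x y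
    using diameter_bounded_bound[OF U(1) that] by (simp add: d_def dist_real_def)
  define a where "a = Inf U"
  have sub: "U \<subseteq> {a .. a + d}"
  proof
    fix y assume y: "y \<in> U"
    have "a \<le> y"
      unfolding a_def using y U(1) by (intro cInf_lower bounded_imp_bdd_below)
    moreover have "y - d \<le> a"
      unfolding a_def
    proof (rule cInf_greatest)
      show "y - d \<le> x" if "x \<in> U" for x
        using dist[OF y that] by linarith
    qed (rule False)
    ultimately show "y \<in> {a .. a + d}" by simp
  qed
  show ?thesis
  proof (cases "d = 0")
    case True
    then have "U \<subseteq> {a}" using sub by simp
    then show ?thesis
      using dyadic_content_mono[of U "{a}" s 0] dyadic_content_singleton[OF s, of a] by simp
  next
    case pos: False
    then have d: "0 < d" "d \<le> 1"
      using U diameter_ge_0[OF U(1)] by (auto simp: d_def)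
    obtain m where m: "d \<le> 1 / 2 ^ m" "1 / 2 ^ Suc m < d"
    proof -
      obtain n where n: "(1 / 2 :: real) ^ n < d"
        using real_arch_pow_inv[of d "1 / 2"] d by auto
      define k where "k = (LEAST n. (1 / 2 :: real) ^ n < d)"
      have k: "(1 / 2 :: real) ^ k < d"
        unfolding k_def by (rule LeastI[of _ n]) (rule n)
      then obtain m where km: "k = Suc m"
        using d by (cases k) auto
      have "\<not> (1 / 2 :: real) ^ m < d"
        using not_less_Least[of m "\<lambda>n. (1 / 2 :: real) ^ n < d"] km by (simp add: k_def)
      then show thesis
        using that[of m] k km by (simp add: power_one_over)
    qed
    have "U \<subseteq> {a .. a + 1 / 2 ^ m}"
      using sub m(1) by fastforce
    then have "dyadic_content s 0 U \<le> 2 * ennreal ((1 / 2 ^ m) powr s)"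
      by (rule dyadic_content_short_interval[OF s])
    also have "\<dots> = ennreal (2 * (1 / 2 ^ m) powr s)"
      by (simp add: ennreal_mult)
    also have "\<dots> \<le> ennreal (2 * 2 powr s * d powr t)"
    proof (rule ennreal_leI)
      have "(1 / 2 ^ m) powr s \<le> (2 * d) powr s"
        using m(2) s by (intro powr_mono2) (auto simp: field_simps)
      also have "\<dots> = 2 powr s * d powr s"
        using d by (simp add: powr_mult)
      also have "\<dots> \<le> 2 powr s * d powr t"
        using d t by (intro mult_left_mono powr_mono') auto
      finally show "2 * (1 / 2 ^ m) powr s \<le> 2 * 2 powr s * d powr t" by simp
    qed
    also have "\<dots> = ennreal (2 * 2 powr s) * diam_gauge t U"
      using False d by (simp add: diam_gauge_def ennreal_mult flip: d_def)
    finally show ?thesis .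
  qed
qed simp

lemma hausdorff_dim_ge_of_dyadic_content:
  fixes S :: "real set"
  assumes s: "0 < s" and pos: "0 < dyadic_content s 0 S"
  shows "ereal s \<le> hausdorff_dim S"
  unfolding hausdorff_dim_def
proof (rule INF_greatest, rule ccontr)
  fix t assume t: "t \<in> {t. 0 \<le> t \<and> hausdorff_measure t S = 0}" and "\<not> ereal s \<le> ereal t"
  then have t: "0 \<le> t" "t \<le> s" and null: "hausdorff_measure t S = 0" by auto
  define K where "K = 2 * 2 powr s"
  have K: "0 < K" by (simp add: K_def)
  have "dyadic_content s 0 S \<le> 0"
  proof (rule ennreal_le_epsilon)
    fix e :: real assume e: "0 < e"
    have "hausdorff_premeasure t 1 S \<le> hausdorff_measure t S"
      unfolding hausdorff_measure_def by (rule SUP_upper) simp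
    then have "hausdorff_premeasure t 1 S < ennreal (e / K)"
      using null e K by simp
    then obtain U where cov: "S \<subseteq> (\<Union>i. U i)" and U: "\<And>i. bounded (U i)" "\<And>i. diameter (U i) \<le> 1"
      and cost: "(\<Sum>i. diam_gauge t (U i)) < ennreal (e / K)"
      unfolding hausdorff_premeasure_def INF_less_iff by blast
    have "dyadic_content s 0 S \<le> dyadic_content s 0 (\<Union>i. U i)"
      by (rule dyadic_content_mono[OF cov])
    also have "\<dots> \<le> (\<Sum>i. dyadic_content s 0 (U i))"
      by (rule dyadic_content_countable_subadditive)
    also have "\<dots> \<le> (\<Sum>i. ennreal K * diam_gauge t (U i))"
      unfolding K_def using U by (intro suminf_le dyadic_content_le_diam_gauge s t) auto
    also have "\<dots> = ennreal K * (\<Sum>i. diam_gauge t (U i))"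
      by (rule ennreal_suminf_cmult)
    also have "\<dots> \<le> ennreal K * ennreal (e / K)"
      using cost by (intro mult_left_mono) auto
    also have "\<dots> = ennreal e"
      using K e by (simp flip: ennreal_mult)
    finally show "dyadic_content s 0 S \<le> 0 + ennreal e" by simp
  qed
  then show False using pos by simp
qed

text \<open>The interval \<open>{0..<1}\<close> is the dyadic interval of level \<open>0\<close> at which the descent through the halves
  starts; it also bounds the content by \<open>1\<close>.\<close>

theorem compact_subset_hausdorff_dim_eq:
  assumes s: "0 < s" and A: "compact A" "A \<subseteq> {0..<1}" and pos: "0 < dyadic_content s 0 A"
  obtains E where "E \<subseteq> A" "compact E" "hausdorff_dim E = ereal s"
proof -
  obtain E where E: "E \<subseteq> A" "compact E" "dyadic_content s 0 E = dyadic_content s 0 A"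
    and min: "\<And>E'. closed E' \<Longrightarrow> E' \<subset> E \<Longrightarrow> dyadic_content s 0 E' < dyadic_content s 0 E"
    using minimal_content_subset[OF s A(1)] by blast
  have unit: "dyadic_interval 0 0 = {0..<1}"
    by (simp add: dyadic_interval_def)
  have EI: "E \<inter> dyadic_interval 0 0 = E"
    using E A unit by blast
  have "dyadic_content s n E < ennreal 2" for n
  proof -
    have "dyadic_content s n (E \<inter> dyadic_interval 0 0) \<le> dyadic_content s 0 (E \<inter> dyadic_interval 0 0)"
      using E min by (intro dyadic_content_fine_le_coarse minimal_content_additive s)
        (auto simp: compact_imp_closed)
    also have "\<dots> \<le> diam_gauge s (dyadic_interval 0 0)"
      using dyadic_interval_memI[of 0 0 0] by (intro dyadic_content_le_gauge) auto
    also have "\<dots> = 1"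
      using s by (simp add: diam_gauge_dyadic_interval)
    finally show ?thesis
      unfolding EI by (rule le_less_trans) simp
  qed
  then have "hausdorff_dim E \<le> ereal s"
    using s by (intro hausdorff_dim_le_of_dyadic_content[of s E 2]) auto
  moreover have "ereal s \<le> hausdorff_dim E"
    using s pos E by (intro hausdorff_dim_ge_of_dyadic_content) auto
  ultimately show thesis
    using that E by (auto intro: antisym)
qed

section \<open>Contact sets of supporting lines\<close>

text \<open>The image of a set of diameter \<open>d\<close> under \<open>g\<close> lies in an interval of length \<open>2 K d\<^sup>s\<close>, so a cheap covering
  of \<open>A\<close> would give a covering of \<open>{a..b}\<close> of total length less than \<open>b - a\<close>.\<close>

lemma dyadic_content_pos_of_holder_onto:
  fixes g :: "real \<Rightarrow> real"
  assumes s: "0 < s" and K: "0 < K"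
    and holder: "\<And>x y. x \<in> A \<Longrightarrow> y \<in> A \<Longrightarrow> \<bar>g x - g y\<bar> \<le> K * \<bar>x - y\<bar> powr s"
    and onto: "{a..b} \<subseteq> g ` A" and ab: "a < b"
  shows "0 < dyadic_content s 0 A"
proof -
  have "ennreal ((b - a) / (2 * K)) \<le> dyadic_content s 0 A"
    unfolding dyadic_content_def
  proof (rule INF_greatest)
    fix U assume "U \<in> dyadic_covers 0 A"
    then have cov: "A \<subseteq> (\<Union>i. U i)" and U: "\<And>i. U i \<in> insert {} (dyadic_intervals 0)"
      by (auto simp: dyadic_covers_def)
    have bdd: "bounded (U i)" for i
      using U[of i] by (auto simp: dyadic_intervals_def bounded_dyadic_interval)
    have "\<exists>B \<in> sets lborel. g ` (A \<inter> U i) \<subseteq> B \<and> emeasure lborel B \<le> ennreal (2 * K) * diam_gauge s (U i)"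
      for i
    proof (cases "A \<inter> U i = {}")
      case True
      then show ?thesis by (intro bexI[of _ "{}"]) auto
    next
      case False
      then obtain x where x: "x \<in> A" "x \<in> U i" by blast
      define r where "r = K * diameter (U i) powr s"
      have r: "0 \<le> r" using K by (simp add: r_def)
      have "g y \<in> {g x - r .. g x + r}" if "y \<in> A" "y \<in> U i" for y
      proof -
        have "\<bar>y - x\<bar> \<le> diameter (U i)"
          using diameter_bounded_bound[OF bdd that(2) x(2)] by (simp add: dist_real_def)
        then have "\<bar>g y - g x\<bar> \<le> r"
          unfolding r_def using holder[OF that(1) x(1)] K s
          by (meson abs_ge_zero less_imp_le mult_left_mono order_trans powr_mono2)
        then show ?thesis by (auto simp: abs_le_iff)
      qed
      moreover have "emeasure lborel {g x - r .. g x + r} = ennreal (2 * K) * diam_gauge s (U i)"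
        using r K s x by (auto simp: diam_gauge_def r_def simp flip: ennreal_mult)
      ultimately show ?thesis
        by (intro bexI[of _ "{g x - r .. g x + r}"]) auto
    qed
    then obtain B where B: "\<And>i. B i \<in> sets lborel" "\<And>i. g ` (A \<inter> U i) \<subseteq> B i"
      "\<And>i. emeasure lborel (B i) \<le> ennreal (2 * K) * diam_gauge s (U i)"
      by metis
    have "{a..b} \<subseteq> (\<Union>i. B i)"
    proof
      fix y assume "y \<in> {a..b}"
      then obtain x where x: "x \<in> A" "y = g x"
        using onto by blast
      then obtain i where "x \<in> U i"
        using cov by blast
      then show "y \<in> (\<Union>i. B i)"
        using x B(2)[of i] by blast
    qed
    then have "emeasure lborel {a..b} \<le> emeasure lborel (\<Union>i. B i)"
      using B(1) by (intro emeasure_mono) auto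
    also have "\<dots> \<le> (\<Sum>i. emeasure lborel (B i))"
      using B(1) by (intro emeasure_subadditive_countably) auto
    also have "\<dots> \<le> (\<Sum>i. ennreal (2 * K) * diam_gauge s (U i))"
      using B(3) by (intro suminf_le) auto
    also have "\<dots> = ennreal (2 * K) * (\<Sum>i. diam_gauge s (U i))"
      by (rule ennreal_suminf_cmult)
    also have "emeasure lborel {a..b} = ennreal (2 * K) * ennreal ((b - a) / (2 * K))"
      using ab K by (simp flip: ennreal_mult)
    finally show "ennreal ((b - a) / (2 * K)) \<le> (\<Sum>i. diam_gauge s (U i))"
      using K by (subst (asm) ennreal_mult_le_mult_iff) auto
  qed
  moreover have "0 < ennreal ((b - a) / (2 * K))"
    using ab K by simp
  ultimately show ?thesis by (rule less_le_trans[rotated])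
qed

lemma restr_convex_of_supporting_lines:
  assumes "\<And>x y. x \<in> A \<Longrightarrow> y \<in> A \<Longrightarrow> f x + d x * (y - x) \<le> f y"
  shows "restr_convex A f"
  unfolding restr_convex_def
proof (intro ballI impI, elim conjE)
  fix x1 x2 x3 assume A: "x1 \<in> A" "x2 \<in> A" "x3 \<in> A" and lt: "x1 < x2" "x2 < x3"
  have "(f x2 - f x1) / (x2 - x1) \<le> d x2"
    using assms[OF A(2,1)] lt by (simp add: pos_divide_le_eq algebra_simps)
  also have "\<dots> \<le> (f x3 - f x2) / (x3 - x2)"
    using assms[OF A(2,3)] lt by (simp add: pos_le_divide_eq algebra_simps)
  finally show "(f x2 - f x1) / (x2 - x1) \<le> (f x3 - f x2) / (x3 - x2)" .
qed

lemma restr_convex_subset: "restr_convex A f \<Longrightarrow> B \<subseteq> A \<Longrightarrow> restr_convex B f"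
  unfolding restr_convex_def by blast

lemma convex_restriction_below_chord:
  fixes f f' :: "real \<Rightarrow> real"
  assumes s: "0 < s" and K: "0 < K"
    and deriv: "\<And>x. x \<in> {0..1} \<Longrightarrow> (f has_real_derivative f' x) (at x within {0..1})"
    and holder: "\<And>x y. x \<in> {0..1} \<Longrightarrow> y \<in> {0..1} \<Longrightarrow> \<bar>f' x - f' y\<bar> \<le> K * \<bar>x - y\<bar> powr s"
    and p: "p \<in> {0..1}" and below: "f p < f 0 + (f 1 - f 0) * p"
  shows "\<exists>E. closed E \<and> E \<subseteq> {0..1} \<and> hausdorff_dim E = ereal s \<and> restr_convex E f"
proof -
  define \<sigma> where "\<sigma> = f 1 - f 0"
  define m where "m = f 0 + \<sigma> * p - f p"
  have m: "0 < m" using below by (simp add: m_def \<sigma>_def)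
  \<comment> \<open>The slopes begin at \<open>\<sigma>\<close> to keep \<open>0\<close> from being a contact point; lines of slope up to \<open>\<sigma> + m / 2\<close>
    through the right endpoint of the graph still pass above \<open>(p, f p)\<close>, which excludes \<open>1\<close>.\<close>
  define J where "J = {\<sigma> .. \<sigma> + m / 2}"
  have interior: "0 < x \<and> x < 1"
    if x: "x \<in> {0..1}" and t: "t \<in> J" and supp: "\<And>y. y \<in> {0..1} \<Longrightarrow> f x + t * (y - x) \<le> f y" for x t
  proof -
    have "x \<noteq> 0"
    proof
      assume "x = 0"
      then have "f 0 + t * p \<le> f p" using supp[OF p] by simp
      moreover have "\<sigma> * p \<le> t * p" using t p by (intro mult_right_mono) (auto simp: J_def)
      ultimately show False using m by (simp add: m_def)
    qed
    moreover have "x \<noteq> 1"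
    proof
      assume "x = 1"
      then have "f 1 - t * (1 - p) \<le> f p" using supp[OF p] by (simp add: algebra_simps)
      moreover have "(t - \<sigma>) * (1 - p) \<le> (m / 2) * 1"
        using t p m by (intro mult_mono) (auto simp: J_def)
      ultimately show False using m by (simp add: m_def \<sigma>_def algebra_simps)
    qed
    ultimately show ?thesis using x by auto
  qed
  have contf: "continuous_on {0..1} f"
    using deriv by (intro continuous_on_eq_continuous_within[THEN iffD2] ballI DERIV_continuous)
  have contf': "continuous_on {0..1} f'"
  proof (rule continuous_onI)
    fix x e :: real
    assume x: "x \<in> {0..1}" and e: "0 < e"
    show "\<exists>d>0. \<forall>y\<in>{0..1}. dist y x < d \<longrightarrow> dist (f' y) (f' x) \<le> e"
    proof (intro exI[of _ "(e / K) powr (1 / s)"] conjI ballI impI)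
      show "0 < (e / K) powr (1 / s)" using e K by simp
      fix y assume y: "y \<in> {0..1}" and "dist y x < (e / K) powr (1 / s)"
      then have "\<bar>y - x\<bar> powr s \<le> ((e / K) powr (1 / s)) powr s"
        using s by (intro powr_mono2) (auto simp: dist_real_def)
      also have "\<dots> = e / K" using s e K by (simp add: powr_powr)
      finally have "K * \<bar>y - x\<bar> powr s \<le> e"
        using K by (simp add: pos_le_divide_eq mult.commute)
      then show "dist (f' y) (f' x) \<le> e"
        using holder[OF y x] by (simp add: dist_real_def)
    qed
  qed
  define A where "A = {x \<in> {0..1}. f' x \<in> J \<and> (\<forall>y\<in>{0..1}. f x + f' x * (y - x) \<le> f y)}"
  have A01: "A \<subseteq> {0..1}" by (auto simp: A_def)
  have "closed A"
  proof -
    have "A = {x \<in> {0..1}. \<sigma> \<le> f' x} \<inter> {x \<in> {0..1}. f' x \<le> \<sigma> + m / 2} \<inter>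
        (\<Inter>y\<in>{0..1}. {x \<in> {0..1}. f x + f' x * (y - x) \<le> f y})"
      by (auto simp: A_def J_def)
    also have "closed \<dots>"
      by (intro closed_Int closed_INT ballI continuous_on_closed_Collect_le continuous_intros contf contf') auto
    finally show ?thesis .
  qed
  then have "compact A"
    using A01 by (metis compact_Icc compact_Int_closed inf.absorb_iff2)
  moreover have "A \<subseteq> {0..<1}"
  proof
    fix x assume "x \<in> A"
    then show "x \<in> {0..<1}"
      using interior[of x "f' x"] by (auto simp: A_def)
  qed
  moreover have "J \<subseteq> f' ` A"
  proof
    fix t assume t: "t \<in> J"
    have "\<exists>x\<in>{0..1}. \<forall>y\<in>{0..1}. f x - t * x \<le> f y - t * y"
      by (intro continuous_attains_inf continuous_intros contf) auto
    then obtain x where x: "x \<in> {0..1}" and "\<And>y. y \<in> {0..1} \<Longrightarrow> f x - t * x \<le> f y - t * y"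
      by blast
    then have supp: "\<And>y. y \<in> {0..1} \<Longrightarrow> f x + t * (y - x) \<le> f y"
      by (simp add: algebra_simps)
    have x01: "0 < x" "x < 1"
      using interior[OF x t supp] by auto
    have "(f has_real_derivative f' x) (at x)"
      using deriv[OF x] x01 by (simp add: at_within_Icc_at)
    then have D: "((\<lambda>y. f y - t * y) has_real_derivative f' x - t) (at x)"
      by (auto intro!: derivative_eq_intros)
    have "f' x - t = 0"
    proof (rule DERIV_local_min[OF D])
      show "0 < min x (1 - x)" using x01 by simp
      show "\<forall>y. \<bar>x - y\<bar> < min x (1 - x) \<longrightarrow> f x - t * x \<le> f y - t * y"
        using supp by (auto simp: abs_less_iff algebra_simps)
    qed
    then have "f' x = t" by simp
    then have "x \<in> A" using x t supp by (simp add: A_def)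
    then show "t \<in> f' ` A" using \<open>f' x = t\<close> by blast
  qed
  then have "0 < dyadic_content s 0 A"
    using A01 m by (intro dyadic_content_pos_of_holder_onto[OF s K holder, of A \<sigma> "\<sigma> + m / 2"])
      (auto simp: J_def)
  ultimately obtain E where E: "E \<subseteq> A" "compact E" "hausdorff_dim E = ereal s"
    using compact_subset_hausdorff_dim_eq[OF s] by blast
  have "restr_convex A f"
    by (rule restr_convex_of_supporting_lines[of _ f f']) (auto simp: A_def)
  then have "restr_convex E f"
    using E(1) by (rule restr_convex_subset)
  then show ?thesis
    using E A01 by (blast intro: compact_imp_closed)
qed

lemma restr_concave_uminus: "restr_convex A (\<lambda>x. - f x) \<Longrightarrow> restr_concave A f"
proof -
  have "(- f x - - f y) / (x - y) = - ((f x - f y) / (x - y))" for x y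
    by (simp add: minus_divide_left)
  then show "restr_convex A (\<lambda>x. - f x) \<Longrightarrow> restr_concave A f"
    by (simp only: restr_convex_def restr_concave_def neg_le_iff_le)
qed

text \<open>For \<open>\<alpha> = 2\<close> the derivative is Lipschitz because \<open>f''\<close> is bounded, so the exponent \<open>2\<close> needs no separate
  treatment in what follows.\<close>

lemma C_class_holder_derivative:
  assumes f: "f \<in> C_class \<alpha>"
  obtains f' K where "0 < K"
    "\<And>x. x \<in> {0..1} \<Longrightarrow> (f has_real_derivative f' x) (at x within {0..1})"
    "\<And>x y. x \<in> {0..1} \<Longrightarrow> y \<in> {0..1} \<Longrightarrow> \<bar>f' x - f' y\<bar> \<le> K * \<bar>x - y\<bar> powr (\<alpha> - 1)"
proof (cases "\<alpha> = 2")
  case True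
  then have "f \<in> twice_cont_diff_class"
    using f by (simp add: C_class_def)
  then obtain f' f'' where f': "\<And>x. x \<in> {0..1} \<Longrightarrow> (f has_real_derivative f' x) (at x within {0..1})"
    and f'': "\<And>x. x \<in> {0..1} \<Longrightarrow> (f' has_real_derivative f'' x) (at x within {0..1})"
    and cont: "continuous_on {0..1} f''"
    unfolding twice_cont_diff_class_def by blast
  have "bounded (f'' ` {0..1})"
    by (intro compact_imp_bounded compact_continuous_image cont) simp
  then obtain K where K: "0 < K" "\<And>x. x \<in> {0..1} \<Longrightarrow> norm (f'' x) \<le> K"
    by (auto simp: bounded_pos)
  have "norm (f' x - f' y) \<le> K * norm (x - y)" if "x \<in> {0..1}" "y \<in> {0..1}" for x y
    using f'' K(2) that by (intro field_differentiable_bound[of "{0..1}"]) auto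
  then show thesis
    using that[OF K(1) f'] True by simp
next
  case False
  then have "f \<in> holder_deriv_class \<alpha>"
    using f by (simp add: C_class_def)
  then obtain f' where f': "\<And>x. x \<in> {0..1} \<Longrightarrow> (f has_real_derivative f' x) (at x within {0..1})"
    and "bdd_above {\<bar>f' x - f' y\<bar> / \<bar>x - y\<bar> powr (\<alpha> - 1) | x y.
                     x \<in> {0..1} \<and> y \<in> {0..1} \<and> x \<noteq> y}"
    unfolding holder_deriv_class_def by blast
  then obtain K where K: "\<bar>f' x - f' y\<bar> / \<bar>x - y\<bar> powr (\<alpha> - 1) \<le> K"
    if "x \<in> {0..1}" "y \<in> {0..1}" "x \<noteq> y" for x y
    unfolding bdd_above_def by blast
  show thesis
  proof (rule that[of "max K 1" f'])
    show "\<bar>f' x - f' y\<bar> \<le> max K 1 * \<bar>x - y\<bar> powr (\<alpha> - 1)" if "x \<in> {0..1}" "y \<in> {0..1}" for x y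
    proof (cases "x = y")
      case False
      then have "\<bar>f' x - f' y\<bar> \<le> K * \<bar>x - y\<bar> powr (\<alpha> - 1)"
        using K[OF that] by (simp add: pos_divide_le_eq)
      also have "\<dots> \<le> max K 1 * \<bar>x - y\<bar> powr (\<alpha> - 1)"
        by (intro mult_right_mono) auto
      finally show ?thesis .
    qed simp
  qed (use f' in auto)
qed

theorem theorem7:
  fixes \<alpha> :: real and f :: "real \<Rightarrow> real"
  assumes "1 < \<alpha>" and "\<alpha> \<le> 2"
    and "f \<in> C_class \<alpha>"
  shows "\<exists>A. closed A \<and> A \<subseteq> {0..1} \<and> hausdorff_dim A = ereal (\<alpha> - 1) \<and>
             (restr_convex A f \<or> restr_concave A f)"
proof -
  define s where "s = \<alpha> - 1"
  have s: "0 < s" "s \<le> 1" using assms by (auto simp: s_def)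
  obtain f' K where K: "0 < K"
    and deriv: "\<And>x. x \<in> {0..1} \<Longrightarrow> (f has_real_derivative f' x) (at x within {0..1})"
    and holder: "\<And>x y. x \<in> {0..1} \<Longrightarrow> y \<in> {0..1} \<Longrightarrow> \<bar>f' x - f' y\<bar> \<le> K * \<bar>x - y\<bar> powr s"
    by (rule C_class_holder_derivative[OF assms(3), folded s_def]) (rule that)
  define l where "l x = f 0 + (f 1 - f 0) * x" for x
  consider (below) p where "p \<in> {0..1}" "f p < l p" | (above) p where "p \<in> {0..1}" "f p > l p"
    | (affine) "\<forall>x\<in>{0..1}. f x = l x"
  proof (cases "\<forall>x\<in>{0..1}. f x = l x")
    case False
    then obtain p where p: "p \<in> {0..1}" "f p \<noteq> l p" by blast
    show thesis
    proof (cases "f p < l p")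
      case True
      with p(1) show thesis by (rule below)
    next
      case False
      with p(2) have "f p > l p" by simp
      with p(1) show thesis by (rule above)
    qed
  qed (rule affine)
  then show ?thesis
  proof cases
    case below
    from convex_restriction_below_chord[OF s(1) K deriv holder below(1)] show ?thesis
      using below(2) unfolding l_def s_def by blast
  next
    case above
    have "\<exists>E. closed E \<and> E \<subseteq> {0..1} \<and> hausdorff_dim E = ereal s \<and> restr_convex E (\<lambda>x. - f x)"
    proof (rule convex_restriction_below_chord[OF s(1) K _ _ above(1)])
      show "((\<lambda>x. - f x) has_real_derivative - f' x) (at x within {0..1})" if "x \<in> {0..1}" for x
        using deriv[OF that] by (rule DERIV_minus)
      show "\<bar>- f' x - - f' y\<bar> \<le> K * \<bar>x - y\<bar> powr s" if "x \<in> {0..1}" "y \<in> {0..1}" for x y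
        using holder[OF that] by (simp add: abs_minus_commute)
      show "- f p < - f 0 + (- f 1 - - f 0) * p"
        using above(2) by (simp add: l_def algebra_simps)
    qed
    then show ?thesis
      unfolding s_def using restr_concave_uminus by blast
  next
    case affine
    \<comment> \<open>Every subset of \<open>[0,1]\<close> is suitable here. As \<open>s \<le> 1\<close>, the identity is an \<open>s\<close>-Hoelder map of
      \<open>[0,1/2]\<close> onto itself, so that the same criterion gives positive content.\<close>
    have "0 < dyadic_content s 0 {0..1/2}"
    proof (rule dyadic_content_pos_of_holder_onto[OF s(1), of 1 _ "\<lambda>x. x" 0 "1 / 2"])
      show "\<bar>x - y\<bar> \<le> 1 * \<bar>x - y\<bar> powr s" if "x \<in> {0..1/2}" "y \<in> {0..1/2}" for x y :: real
        using powr_mono'[OF s(2), of "\<bar>x - y\<bar>"] that by (auto simp: abs_le_iff)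
    qed auto
    moreover have "{0..1/2} \<subseteq> {0..<1::real}" by auto
    ultimately obtain E :: "real set" where E: "E \<subseteq> {0..1/2}" "compact E" "hausdorff_dim E = ereal s"
      using compact_subset_hausdorff_dim_eq[OF s(1) compact_Icc] by blast
    have E01: "E \<subseteq> {0..1}" using E(1) by fastforce
    have "restr_convex E f"
    proof (rule restr_convex_of_supporting_lines[of _ f "\<lambda>_. f 1 - f 0"])
      show "f x + (f 1 - f 0) * (y - x) \<le> f y" if "x \<in> E" "y \<in> E" for x y
      proof -
        have "f x = l x" "f y = l y"
          using affine that E01 by blast+
        then show ?thesis by (simp add: l_def algebra_simps)
      qed
    qed
    then show ?thesis
      using E E01 unfolding s_def by (blast intro: compact_imp_closed)
  qed
qed

end
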